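(* Let $\Phi=\{\varphi^t\}_{t\in\mathbb{R}}$ be the flow of the vector field $f$ on $M$ and let $\Phi_r=\{\varphi_r^\tau\}_{\tau\in\mathbb{R}}$ be a time reparameterization of $\Phi$ with associated function $r$. For $x\in\widehat M$ and $v\in T_xM$, the maps $t\mapsto y(t)=D_x\varphi^t(v)$ and $\tau\mapsto z(\tau)=D_x\varphi_r^\tau(v)$ satisfy $$z(\tau(x,t)) = y(t)+\varkappa(t)\,\Big(\frac{f}{r}\Big)(\varphi^t(x))$$ for every $t$, where the function $\varkappa\colon\mathbb{R}\to\mathbb{R}$ is given by $$\varkappa(t)=-\int_0^t Dr(\varphi^s(x))\cdot y(s)\,ds .$$
   Context: Setting. $M$ is a manifold of class $C^m$, $m\ge 2$, with a Riemannian metric of class $C^{m-1}$, and $f$ is a $C^\ell$ vector field on $M$, $1\le \ell<m$, such that $dx/dt=f(x)$ generates a $C^\ell$ flow $\Phi=\{\varphi^t\}_{t\in\mathbb{R}}$ on $M$. A $C^\ell$ flow $\Phi_r=\{\varphi^\tau_r\}_{\tau\in\mathbb{R}}$ on $M$ is a time reparameterization of $\Phi$ if for every $x\in M$ the orbits $\{\varphi_r^\tau(x)\}_\tau$ and $\{\varphi^t(x)\}_t$ coincide and have the same orientation. Its associated function $r\ge 0$ is positive and of class $C^{\ell-1}$ at every non-fixed point and is given there by $r(x)=\big(\frac{\partial}{\partial\tau}t(x,\tau)|_{\tau=0}\big)^{-1}$, where $\varphi_r^\tau(x)=\varphi^{t(x,\tau)}(x)$. Thus $d\tau=r(x)\,dt$,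 and $\tau\mapsto\varphi_r^\tau(x)$ solves $dx/d\tau=f(x)/r(x)$. Notation. $\widehat M=\{x\in M: f(x)\neq 0\}$, except that $\widehat M=M$ in the case where $r$ is positive and of class $C^{\ell-1}$ on all of $M$. For $x\in\widehat M$ and $t\in\mathbb{R}$, $\tau(x,t)=\int_0^t r(\varphi^s(x))\,ds$, so that $\varphi_r^{\tau(x,t)}(x)=\varphi^t(x)$. $D_x\varphi^t(v)$ and $D_x\varphi_r^\tau(v)$ denote the derivatives of the flow maps at $x$ applied to $v$, and $Dr$ denotes the derivative of $r$. The maps $y$ and $z$ are the solutions, with $y(0)=z(0)=v$, of the variational equations of the two flows along the orbit of $x$.
   Formalization: For ℓ = 1 the setting only makes r continuous, so Dr need not exist; in that case it is additionally assumed that r is of class C¹ on an open set containing the orbit of x. Nothing is added for ℓ ≥ 2. *)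

theory Defs
  imports "HOL-Analysis.Analysis"
begin

text \<open>On an open subset \<open>S\<close> of a finite-dimensional space this is the usual class \<open>C\<^sup>k\<close>: a map
  is \<open>C\<^sup>k\<^sup>+\<^sup>1\<close> iff it is differentiable and all its directional derivatives are \<open>C\<^sup>k\<close>.\<close>

primrec Ck_on :: "nat \<Rightarrow> ('b::real_normed_vector \<Rightarrow> 'c::real_normed_vector) \<Rightarrow> 'b set \<Rightarrow> bool" where
  "Ck_on 0 h S \<longleftrightarrow> continuous_on S h"
| "Ck_on (Suc k) h S \<longleftrightarrow>
     (\<forall>x\<in>S. h differentiable (at x)) \<and> (\<forall>v. Ck_on k (\<lambda>x. frechet_derivative h (at x) v) S)"


section \<open>Manifolds and tangent vectors\<close>

text \<open>The manifold is a whole type \<open>'a\<close>. A chart is a pair of a domain and a coordinate map, whose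
  values off the domain are irrelevant.\<close>

type_synonym ('a, 'e) chart = "'a set \<times> ('a \<Rightarrow> 'e)"

abbreviation chart_inv :: "('a, 'e) chart \<Rightarrow> 'e \<Rightarrow> 'a" where
  "chart_inv c \<equiv> inv_into (fst c) (snd c)"

definition Ck_manifold ::
  "nat \<Rightarrow> ('a::{t2_space, second_countable_topology}, 'e::euclidean_space) chart set \<Rightarrow> bool" where
  "Ck_manifold m A \<longleftrightarrow>
     (\<Union>c\<in>A. fst c) = UNIV \<and>
     (\<forall>c\<in>A. open (fst c) \<and> open (snd c ` fst c) \<and>
        homeomorphism (fst c) (snd c ` fst c) (snd c) (chart_inv c)) \<and>
     (\<forall>c\<in>A. \<forall>d\<in>A. Ck_on m (snd d \<circ> chart_inv c) (snd c ` (fst c \<inter> fst d)))"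

definition charts_at :: "('a, 'e) chart set \<Rightarrow> 'a \<Rightarrow> ('a, 'e) chart set" where
  "charts_at A x = {c\<in>A. x \<in> fst c}"

text \<open>A tangent vector at \<open>x\<close> is the family of its coordinate vectors in all charts around \<open>x\<close>,
  related by the derivatives of the coordinate changes. It is set to \<open>0\<close> at all other charts, so
  that equality of tangent vectors is equality of functions.\<close>

type_synonym ('a, 'e) tvec = "('a, 'e) chart \<Rightarrow> 'e"

definition tangent_space ::
  "('a, 'e::euclidean_space) chart set \<Rightarrow> 'a \<Rightarrow> ('a, 'e) tvec set" where
  "tangent_space A x =
     {v. (\<forall>c. c \<notin> charts_at A x \<longrightarrow> v c = 0) \<and>
         (\<forall>c\<in>charts_at A x. \<forall>d\<in>charts_at A x.
            v d = frechet_derivative (snd d \<circ> chart_inv c) (at (snd c x)) (v c))}"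

definition tzero :: "('a, 'e::euclidean_space) tvec" where
  "tzero = (\<lambda>c. 0)"

definition tadd ::
  "('a, 'e::euclidean_space) tvec \<Rightarrow> ('a, 'e) tvec \<Rightarrow> ('a, 'e) tvec" where
  "tadd u v = (\<lambda>c. u c + v c)"

definition tscale :: "real \<Rightarrow> ('a, 'e::euclidean_space) tvec \<Rightarrow> ('a, 'e) tvec" where
  "tscale a v = (\<lambda>c. a *\<^sub>R v c)"

text \<open>The tangent vector at \<open>x\<close> with coordinate vector \<open>w\<close> in the chart \<open>c\<close>.\<close>

definition tvec_of ::
  "('a, 'e::euclidean_space) chart set \<Rightarrow> 'a \<Rightarrow> ('a, 'e) chart \<Rightarrow> 'e \<Rightarrow> ('a, 'e) tvec" where
  "tvec_of A x c w =
     (\<lambda>d. if d \<in> charts_at A x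
          then frechet_derivative (snd d \<circ> chart_inv c) (at (snd c x)) w else 0)"

definition riemannian_metric ::
  "nat \<Rightarrow> ('a, 'e::euclidean_space) chart set \<Rightarrow> ('a \<Rightarrow> ('a, 'e) tvec \<Rightarrow> ('a, 'e) tvec \<Rightarrow> real) \<Rightarrow> bool"
  where
  "riemannian_metric k A g \<longleftrightarrow>
     (\<forall>x. \<forall>u\<in>tangent_space A x. \<forall>v\<in>tangent_space A x. g x u v = g x v u) \<and>
     (\<forall>x. \<forall>u\<in>tangent_space A x. \<forall>v\<in>tangent_space A x. \<forall>w\<in>tangent_space A x. \<forall>a.
        g x (tadd u (tscale a v)) w = g x u w + a * g x v w) \<and>
     (\<forall>x. \<forall>u\<in>tangent_space A x. u \<noteq> tzero \<longrightarrow> g x u u > 0) \<and>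
     (\<forall>c\<in>A. \<forall>u w. Ck_on k
        (\<lambda>p. g (chart_inv c p) (tvec_of A (chart_inv c p) c u) (tvec_of A (chart_inv c p) c w))
        (snd c ` fst c))"


section \<open>Functions, vector fields and differentials\<close>

text \<open>A real function of class \<open>C\<^sup>k\<close> on an open set \<open>S\<close>.\<close>

definition Ck_fun ::
  "nat \<Rightarrow> ('a, 'e::euclidean_space) chart set \<Rightarrow> ('a \<Rightarrow> real) \<Rightarrow> 'a set \<Rightarrow> bool" where
  "Ck_fun k A h S \<longleftrightarrow> (\<forall>c\<in>A. Ck_on k (h \<circ> chart_inv c) (snd c ` (fst c \<inter> S)))"

definition Ck_vector_field ::
  "nat \<Rightarrow> ('a, 'e::euclidean_space) chart set \<Rightarrow> ('a \<Rightarrow> ('a, 'e) tvec) \<Rightarrow> bool" where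
  "Ck_vector_field k A f \<longleftrightarrow>
     (\<forall>x. f x \<in> tangent_space A x) \<and>
     (\<forall>c\<in>A. Ck_on k (\<lambda>p. f (chart_inv c p) c) (snd c ` fst c))"

text \<open>The differentials below are computed in an arbitrary chart around \<open>x\<close>; by the chain rule the
  choice does not matter for differentiable maps.\<close>

definition chart_at :: "('a, 'e) chart set \<Rightarrow> 'a \<Rightarrow> ('a, 'e) chart" where
  "chart_at A x = (SOME c. c \<in> charts_at A x)"

definition fun_differential ::
  "('a, 'e::euclidean_space) chart set \<Rightarrow> ('a \<Rightarrow> real) \<Rightarrow> 'a \<Rightarrow> ('a, 'e) tvec \<Rightarrow> real" where
  "fun_differential A h x v =
     frechet_derivative (h \<circ> chart_inv (chart_at A x)) (at (snd (chart_at A x) x)) (v (chart_at A x))"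

definition map_differential ::
  "('a, 'e::euclidean_space) chart set \<Rightarrow> ('a \<Rightarrow> 'a) \<Rightarrow> 'a \<Rightarrow> ('a, 'e) tvec \<Rightarrow> ('a, 'e) tvec" where
  "map_differential A F x v =
     (\<lambda>d. if d \<in> charts_at A (F x)
          then frechet_derivative (snd d \<circ> F \<circ> chart_inv (chart_at A x))
                 (at (snd (chart_at A x) x)) (v (chart_at A x))
          else 0)"


section \<open>Flows and time reparameterizations\<close>

text \<open>A flow that is of class \<open>C\<^sup>k\<close> as a map on the product of the real line with the manifold.\<close>

definition Ck_flow ::
  "nat \<Rightarrow> ('a::topological_space, 'e::euclidean_space) chart set \<Rightarrow> (real \<Rightarrow> 'a \<Rightarrow> 'a) \<Rightarrow> bool" where
  "Ck_flow k A \<phi> \<longleftrightarrow>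
     (\<forall>x. \<phi> 0 x = x) \<and>
     (\<forall>s t x. \<phi> (s + t) x = \<phi> s (\<phi> t x)) \<and>
     continuous_on UNIV (\<lambda>(t, x). \<phi> t x) \<and>
     (\<forall>c\<in>A. \<forall>d\<in>A. Ck_on k (\<lambda>(t, p). snd d (\<phi> t (chart_inv c p)))
        {(t, p). p \<in> snd c ` fst c \<and> \<phi> t (chart_inv c p) \<in> fst d})"

definition generates ::
  "('a, 'e::euclidean_space) chart set \<Rightarrow> ('a \<Rightarrow> ('a, 'e) tvec) \<Rightarrow> (real \<Rightarrow> 'a \<Rightarrow> 'a) \<Rightarrow> bool" where
  "generates A f \<phi> \<longleftrightarrow>
     (\<forall>x t. \<forall>c\<in>charts_at A (\<phi> t x).
        ((\<lambda>s. snd c (\<phi> s x)) has_vector_derivative f (\<phi> t x) c) (at t))"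

text \<open>\<open>\<theta>\<close> plays the role of \<open>\<tau> \<mapsto> t(x,\<tau>)\<close>. Continuity and \<open>\<theta> 0 = 0\<close> determine it uniquely at every
  non-fixed point, including the periodic ones. That it is increasing expresses that the two orbits
  have the same orientation.\<close>

definition time_change ::
  "(real \<Rightarrow> 'a \<Rightarrow> 'a) \<Rightarrow> (real \<Rightarrow> 'a \<Rightarrow> 'a) \<Rightarrow> 'a \<Rightarrow> (real \<Rightarrow> real) \<Rightarrow> bool" where
  "time_change \<phi> \<phi>r x \<theta> \<longleftrightarrow>
     continuous_on UNIV \<theta> \<and> strict_mono \<theta> \<and> \<theta> 0 = 0 \<and> (\<forall>\<tau>. \<phi>r \<tau> x = \<phi> (\<theta> \<tau>) x)"

definition time_reparameterization ::
  "nat \<Rightarrow> ('a::topological_space, 'e::euclidean_space) chart set \<Rightarrow>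
     (real \<Rightarrow> 'a \<Rightarrow> 'a) \<Rightarrow> (real \<Rightarrow> 'a \<Rightarrow> 'a) \<Rightarrow> bool" where
  "time_reparameterization l A \<phi> \<phi>r \<longleftrightarrow>
     Ck_flow l A \<phi>r \<and>
     (\<forall>x. range (\<lambda>\<tau>. \<phi>r \<tau> x) = range (\<lambda>t. \<phi> t x) \<and> (\<exists>\<theta>. time_change \<phi> \<phi>r x \<theta>))"

definition nonfixed :: "(real \<Rightarrow> 'a \<Rightarrow> 'a) \<Rightarrow> 'a set" where
  "nonfixed \<phi> = {x. \<exists>t. \<phi> t x \<noteq> x}"

definition associated_function ::
  "nat \<Rightarrow> ('a, 'e::euclidean_space) chart set \<Rightarrow>
     (real \<Rightarrow> 'a \<Rightarrow> 'a) \<Rightarrow> (real \<Rightarrow> 'a \<Rightarrow> 'a) \<Rightarrow> ('a \<Rightarrow> real) \<Rightarrow> bool" where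
  "associated_function l A \<phi> \<phi>r r \<longleftrightarrow>
     (\<forall>x. r x \<ge> 0) \<and>
     (\<forall>x\<in>nonfixed \<phi>. r x > 0) \<and>
     Ck_fun (l - 1) A r (nonfixed \<phi>) \<and>
     (\<forall>x\<in>nonfixed \<phi>. \<forall>\<theta>. time_change \<phi> \<phi>r x \<theta> \<longrightarrow>
        (\<exists>d. (\<theta> has_real_derivative d) (at 0) \<and> r x = inverse d))"

definition M_hat ::
  "nat \<Rightarrow> ('a, 'e::euclidean_space) chart set \<Rightarrow>
     ('a \<Rightarrow> ('a, 'e) tvec) \<Rightarrow> ('a \<Rightarrow> real) \<Rightarrow> 'a set" where
  "M_hat l A f r =
     (if (\<forall>x. r x > 0) \<and> Ck_fun (l - 1) A r UNIV then UNIV else {x. f x \<noteq> tzero})"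

definition new_time :: "(real \<Rightarrow> 'a \<Rightarrow> 'a) \<Rightarrow> ('a \<Rightarrow> real) \<Rightarrow> 'a \<Rightarrow> real \<Rightarrow> real" where
  "new_time \<phi> r x t = (LBINT s=0..t. r (\<phi> s x))"

end

theory Submission
  imports Defs
begin

text \<open>Write \<open>T(q) = \<integral>\<^sub>0\<^sup>t r(\<phi>\<^sup>s(q)) ds\<close> for the new time that the point \<open>q\<close> needs to reach \<open>\<phi>\<^sup>t(q)\<close>.
  The formula is the derivative at \<open>q = x\<close>, in the direction \<open>v\<close>, of the identity
  \<open>\<phi>r\<^bsup>T(q)\<^esup>(q) = \<phi>\<^sup>t(q)\<close>, which holds for every \<open>q\<close> (\<open>flow_new_time\<close>). The right-hand side has
  derivative \<open>y(t)\<close>. On the left, the chain rule for \<open>(\<tau>, q) \<mapsto> \<phi>r\<^sup>\<tau>(q)\<close> yields \<open>z(T(x))\<close> from the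
  dependence on \<open>q\<close>, and \<open>DT(v)\<close> times the velocity of \<open>\<phi>r\<close> from the dependence on \<open>\<tau>\<close>. The
  velocity is \<open>f/r\<close> at \<open>\<phi>\<^sup>t(x)\<close> (\<open>reparameterized_velocity\<close>), and differentiation under the
  integral sign gives \<open>DT(v) = \<integral>\<^sub>0\<^sup>t Dr(\<phi>\<^sup>s(x)) y(s) ds = -\<kappa>(t)\<close>
  (\<open>has_derivative_interval_integral\<close>, \<open>fun_differential_along_flow\<close>). Hence
  \<open>y(t) = z(T(x)) - \<kappa>(t) f/r\<close>. In this form the argument avoids the variational equations, which
  for a flow of class \<open>C\<^sup>1\<close> with generator \<open>f/r\<close> would first have to be derived.

  The identity itself is a matter of one orbit. At a fixed point both sides are \<open>q\<close>. At any other
  point the time change \<open>\<theta>\<close> has derivative \<open>1/r\<close> everywhere, because a time change restarted at a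
  later point of the orbit is again a time change. Let \<open>\<tau>(q, t)\<close> be the new time \<open>T(q)\<close> as a function
  of \<open>t\<close> too. Then \<open>\<sigma> \<mapsto> \<tau>(q, \<theta>(\<sigma>))\<close> has derivative \<open>1\<close> and is the identity.
  Since \<open>\<tau>(q, \<sqdot>)\<close> is strictly increasing, this left inverse of \<open>\<theta>\<close> is also a right inverse.
  Fixed points in \<open>M_hat\<close> are covered by the same computation: \<open>f\<close> vanishes there, but
  nearby points need not be fixed, and the identity holds on a whole neighbourhood.\<close>

section \<open>Maps of class \<open>C\<^sup>1\<close>\<close>


lemma Ck_on_Suc_imp: "Ck_on (Suc k) h S \<Longrightarrow> Ck_on k h S"
proof (induction k arbitrary: h)
  case 0
  then show ?case
    by (auto intro!: continuous_at_imp_continuous_on differentiable_imp_continuous_within)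
next
  case (Suc k)
  then show ?case
    by (metis Ck_on.simps(2))
qed

lemma Ck_on_mono:
  assumes "Ck_on k h S" and "j \<le> k"
  shows "Ck_on j h S"
  using assms(2,1) by (induction rule: inc_induct) (blast intro: Ck_on_Suc_imp)+

lemma Ck_on_subset: "Ck_on k h S \<Longrightarrow> T \<subseteq> S \<Longrightarrow> Ck_on k h T"
  by (induction k arbitrary: h) (auto intro: continuous_on_subset)

lemma Ck_on_1_iff:
  "Ck_on 1 h S \<longleftrightarrow>
     (\<forall>x\<in>S. h differentiable (at x)) \<and>
     (\<forall>v. continuous_on S (\<lambda>x. frechet_derivative h (at x) v))"
  unfolding One_nat_def by simp

text \<open>\<open>Ck_on\<close> gives continuity of the derivative only in each fixed direction. In finite dimension
  the derivative is therefore continuous jointly in the point and the direction: expand the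
  direction in the basis.\<close>

lemma continuous_on_frechet_derivative:
  fixes h :: "'b::euclidean_space \<Rightarrow> 'c::real_normed_vector"
  assumes h: "Ck_on 1 h S" and a: "continuous_on X a" "a ` X \<subseteq> S" and u: "continuous_on X u"
  shows "continuous_on X (\<lambda>x. frechet_derivative h (at (a x)) (u x))"
proof -
  have expand: "frechet_derivative h (at (a x)) (u x) =
      (\<Sum>b\<in>Basis. (u x \<bullet> b) *\<^sub>R frechet_derivative h (at (a x)) b)" if "x \<in> X" for x
  proof -
    have "h differentiable (at (a x))"
      using h a(2) that by (auto simp: Ck_on_1_iff)
    then have lin: "linear (frechet_derivative h (at (a x)))"
      by (rule linear_frechet_derivative)
    have "frechet_derivative h (at (a x)) (u x) =
        frechet_derivative h (at (a x)) (\<Sum>b\<in>Basis. (u x \<bullet> b) *\<^sub>R b)"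
      by (simp add: euclidean_representation)
    then show ?thesis
      by (simp add: linear_sum[OF lin] linear_cmul[OF lin])
  qed
  have "continuous_on X (\<lambda>x. frechet_derivative h (at (a x)) b)" for b
    using h unfolding Ck_on_1_iff
    by (intro continuous_on_compose2[OF _ a(1) a(2)]) auto
  then have "continuous_on X
      (\<lambda>x. \<Sum>b\<in>Basis. (u x \<bullet> b) *\<^sub>R frechet_derivative h (at (a x)) b)"
    by (intro continuous_intros u)
  then show ?thesis
    by (simp add: expand cong: continuous_on_cong)
qed

lemma Ck_on_1_compose:
  fixes h :: "'b::euclidean_space \<Rightarrow> 'c::real_normed_vector"
    and k :: "'d::euclidean_space \<Rightarrow> 'b"
  assumes h: "Ck_on 1 h S" and k: "Ck_on 1 k T" and sub: "k ` T \<subseteq> S"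
  shows "Ck_on 1 (\<lambda>x. h (k x)) T"
proof -
  have diff: "((\<lambda>x. h (k x)) has_derivative
      (\<lambda>v. frechet_derivative h (at (k x)) (frechet_derivative k (at x) v))) (at x)"
    if "x \<in> T" for x
  proof -
    have "(k has_derivative frechet_derivative k (at x)) (at x)"
      using k that by (simp add: Ck_on_1_iff frechet_derivative_works)
    moreover have "(h has_derivative frechet_derivative h (at (k x))) (at (k x))"
      using h that sub by (auto simp: Ck_on_1_iff frechet_derivative_works)
    ultimately show ?thesis
      by (rule has_derivative_compose)
  qed
  have "continuous_on T k"
    using Ck_on_mono[OF k, of 0] by simp
  then have "continuous_on T (\<lambda>x. frechet_derivative h (at (k x)) (frechet_derivative k (at x) v))"
    for v
    using k sub by (intro continuous_on_frechet_derivative[OF h]) (auto simp: Ck_on_1_iff)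
  then have "continuous_on T (\<lambda>x. frechet_derivative (\<lambda>x. h (k x)) (at x) v)" for v
    by (rule continuous_on_eq) (simp add: frechet_derivative_at[OF diff, symmetric])
  then show ?thesis
    using diff by (auto simp: Ck_on_1_iff differentiable_def)
qed

text \<open>Composites through a chart of the target are available only where the values stay in the
  domain of that chart, so class \<open>C\<^sup>1\<close> has to be glued from local formulas.\<close>

lemma Ck_on_1_locally:
  assumes "\<And>x. x \<in> S \<Longrightarrow> \<exists>U k. open U \<and> x \<in> U \<and> Ck_on 1 k U \<and> (\<forall>y\<in>U. h y = k y)"
  shows "Ck_on 1 h S"
proof -
  have *: "h differentiable (at x) \<and> isCont (\<lambda>x. frechet_derivative h (at x) v) x"
    if "x \<in> S" for x v
  proof -
    obtain U k where U: "open U" "x \<in> U" and k: "Ck_on 1 k U" and eq: "\<And>y. y \<in> U \<Longrightarrow> h y = k y"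
      using assms[OF \<open>x \<in> S\<close>] by blast
    have der: "(h has_derivative frechet_derivative k (at y)) (at y)" if "y \<in> U" for y
    proof (rule has_derivative_transform_within_open[OF _ U(1) that])
      show "(k has_derivative frechet_derivative k (at y)) (at y)"
        using k that by (simp add: Ck_on_1_iff frechet_derivative_works)
    qed (simp add: eq)
    have "continuous_on U (\<lambda>x. frechet_derivative k (at x) v)"
      using k by (simp add: Ck_on_1_iff)
    then have "continuous_on U (\<lambda>x. frechet_derivative h (at x) v)"
      by (rule continuous_on_eq) (simp add: frechet_derivative_at[OF der, symmetric])
    then show ?thesis
      using U der[OF U(2)] by (auto simp: differentiable_def continuous_on_eq_continuous_at)
  qed
  then show ?thesis
    by (auto simp: Ck_on_1_iff intro: continuous_at_imp_continuous_on)
qed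

section \<open>Integrals depending on a parameter\<close>

text \<open>Since the integrand is \<open>C\<^sup>1\<close> only on an open set around the segment over \<open>p\<close>, the tube lemma
  is used to find a ball around \<open>p\<close> over which the Leibniz rule applies.\<close>

lemma has_derivative_interval_integral:
  fixes h :: "real \<times> 'e::euclidean_space \<Rightarrow> real"
  assumes h: "Ck_on 1 h \<Omega>" and \<Omega>: "open \<Omega>"
    and seg: "\<And>s. s \<in> closed_segment a b \<Longrightarrow> (s, p) \<in> \<Omega>"
  shows "((\<lambda>q. LBINT s=a..b. h (s, q)) has_derivative
      (\<lambda>v. LBINT s=a..b. frechet_derivative (\<lambda>q. h (s, q)) (at p) v)) (at p)"
proof -
  have ordered: "((\<lambda>q. LBINT s=a..b. h (s, q)) has_derivative
      (\<lambda>v. LBINT s=a..b. frechet_derivative (\<lambda>q. h (s, q)) (at p) v)) (at p)"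
    if "a \<le> b" and seg: "\<And>s. s \<in> {a..b} \<Longrightarrow> (s, p) \<in> \<Omega>" for a b :: real
  proof -
    let ?D = "\<lambda>q s v. frechet_derivative h (at (s, q)) (0, v)"
    have swap: "open ((\<lambda>(q, s). (s, q)) -` \<Omega>)"
      by (intro open_vimage \<Omega>) (auto intro!: continuous_intros simp: case_prod_unfold)
    have "{p} \<times> {a..b} \<subseteq> (\<lambda>(q, s). (s, q)) -` \<Omega>"
      using seg by auto
    from Elementary_Topology.tube_lemma[OF compact_Icc swap this]
    obtain V where V: "open V" "p \<in> V" "V \<times> {a..b} \<subseteq> (\<lambda>(q, s). (s, q)) -` \<Omega>"
      by blast
    then obtain e where e: "e > 0" "ball p e \<subseteq> V"
      by (meson open_contains_ball)
    define U where "U = ball p e"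
    have U: "open U" "convex U" "p \<in> U"
      using e(1) by (auto simp: U_def)
    have in\<Omega>: "(s, q) \<in> \<Omega>" if "q \<in> U" "s \<in> {a..b}" for q s
    proof -
      have "(q, s) \<in> V \<times> {a..b}"
        using that e(2) by (auto simp: U_def)
      then have "(q, s) \<in> (\<lambda>(q, s). (s, q)) -` \<Omega>"
        using V(3) by blast
      then show ?thesis
        by simp
    qed
    have der: "((\<lambda>q. h (s, q)) has_derivative ?D q s) (at q)" if "(s, q) \<in> \<Omega>" for q s
    proof -
      have "(h has_derivative frechet_derivative h (at (s, q))) (at (s, q))"
        using h that by (simp add: Ck_on_1_iff frechet_derivative_works)
      then show ?thesis
        by (rule has_derivative_compose[rotated]) (auto intro!: derivative_eq_intros)
    qed
    have bl: "bounded_linear (?D q s)" if "(s, q) \<in> \<Omega>" for q s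
      using der[OF that] by (rule has_derivative_bounded_linear)
    have ap: "blinfun_apply (Blinfun (?D q s)) = ?D q s" if "(s, q) \<in> \<Omega>" for q s
      using bl[OF that] by (rule bounded_linear_Blinfun_apply)
    have conth: "continuous_on \<Omega> h"
      using Ck_on_mono[OF h, of 0] by simp
    have conth': "continuous_on {a..b} (\<lambda>s. h (s, q))" if "q \<in> U" for q
      by (rule continuous_on_compose2[OF conth]) (use in\<Omega> that in \<open>auto intro!: continuous_intros\<close>)
    have contD: "continuous_on (U \<times> {a..b}) (\<lambda>(q, s). ?D q s v)" for v
      unfolding case_prod_unfold
      by (rule continuous_on_frechet_derivative[OF h])
        (use in\<Omega> in \<open>auto intro!: continuous_intros\<close>)
    have contB: "continuous_on (U \<times> {a..b}) (\<lambda>(q, s). Blinfun (?D q s))"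
    proof (rule continuous_on_blinfun_componentwise)
      fix v :: 'e
      show "continuous_on (U \<times> {a..b}) (\<lambda>z. blinfun_apply (case z of (q, s) \<Rightarrow> Blinfun (?D q s)) v)"
        by (rule continuous_on_eq[OF contD[of v]]) (use in\<Omega> ap in auto)
    qed
    have slice: "continuous_on {a..b} (\<lambda>s. (p, s))" "(\<lambda>s. (p, s)) ` {a..b} \<subseteq> U \<times> {a..b}"
      using U(3) by (intro continuous_on_Pair continuous_on_const continuous_on_id, blast)
    have contp: "continuous_on {a..b} (\<lambda>s. Blinfun (?D p s))"
      using continuous_on_compose2[OF contB slice] by simp
    have "((\<lambda>q. integral (cbox a b) (\<lambda>s. h (s, q))) has_derivative
        integral (cbox a b) (\<lambda>s. Blinfun (?D p s))) (at p within U)"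
    proof (rule leibniz_rule[where fx = "\<lambda>q s. Blinfun (?D q s)"])
      show "((\<lambda>q. h (s, q)) has_derivative blinfun_apply (Blinfun (?D q s))) (at q within U)"
        if "q \<in> U" "s \<in> cbox a b" for q s
        using der[of s q] ap[of s q] in\<Omega>[of q s] that
        by (simp add: has_derivative_at_withinI)
      show "(\<lambda>s. h (s, q)) integrable_on cbox a b" if "q \<in> U" for q
        using conth'[OF that] by (simp add: integrable_continuous_real)
      show "continuous_on (U \<times> cbox a b) (\<lambda>(q, s). Blinfun (?D q s))"
        using contB by simp
    qed (use U in auto)
    then have main: "((\<lambda>q. integral {a..b} (\<lambda>s. h (s, q))) has_derivative
        integral {a..b} (\<lambda>s. Blinfun (?D p s))) (at p)"
      using U by (simp add: at_within_open[of p U])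
    have left: "(LBINT s=a..b. h (s, q)) = integral {a..b} (\<lambda>s. h (s, q))" if "q \<in> U" for q
      using \<open>a \<le> b\<close> conth'[OF that]
      by (intro interval_integral_eq_integral) (auto intro: borel_integrable_atLeastAtMost')
    have right: "blinfun_apply (integral {a..b} (\<lambda>s. Blinfun (?D p s))) v =
        (LBINT s=a..b. frechet_derivative (\<lambda>q. h (s, q)) (at p) v)" for v
    proof -
      have eq: "frechet_derivative (\<lambda>q. h (s, q)) (at p) v = ?D p s v" if "s \<in> {a..b}" for s
        using der[of s p] in\<Omega>[OF U(3) that] by (metis frechet_derivative_at)
      have "continuous_on {a..b} (\<lambda>s. ?D p s v)"
        using continuous_on_compose2[OF contD[of v] slice] by simp
      then have cont: "continuous_on {a..b} (\<lambda>s. frechet_derivative (\<lambda>q. h (s, q)) (at p) v)"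
        by (rule continuous_on_eq) (rule eq[symmetric])
      have "blinfun_apply (integral {a..b} (\<lambda>s. Blinfun (?D p s))) v =
          integral {a..b} (\<lambda>s. blinfun_apply (Blinfun (?D p s)) v)"
        by (intro blinfun_apply_integral integrable_continuous_real contp)
      also have "\<dots> = integral {a..b} (\<lambda>s. frechet_derivative (\<lambda>q. h (s, q)) (at p) v)"
        by (rule integral_cong) (use eq ap in\<Omega> U(3) in auto)
      also have "\<dots> = (LBINT s=a..b. frechet_derivative (\<lambda>q. h (s, q)) (at p) v)"
        using \<open>a \<le> b\<close> cont
        by (intro interval_integral_eq_integral[symmetric])
          (auto intro: borel_integrable_atLeastAtMost')
      finally show ?thesis .
    qed
    have "((\<lambda>q. LBINT s=a..b. h (s, q)) has_derivative
        integral {a..b} (\<lambda>s. Blinfun (?D p s))) (at p)"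
      by (rule has_derivative_transform_within_open[OF main U(1,3)]) (simp add: left)
    moreover have "blinfun_apply (integral {a..b} (\<lambda>s. Blinfun (?D p s))) =
        (\<lambda>v. LBINT s=a..b. frechet_derivative (\<lambda>q. h (s, q)) (at p) v)"
      using right by blast
    ultimately show ?thesis
      by simp
  qed
  show ?thesis
  proof (cases "a \<le> b")
    case True
    then show ?thesis
      using ordered[of a b] seg by (simp add: closed_segment_eq_real_ivl)
  next
    case False
    then have "((\<lambda>q. - (LBINT s=b..a. h (s, q))) has_derivative
        (\<lambda>v. - (LBINT s=b..a. frechet_derivative (\<lambda>q. h (s, q)) (at p) v))) (at p)"
      using ordered[of b a] seg
      by (intro has_derivative_minus) (auto simp: closed_segment_eq_real_ivl)
    then show ?thesis
      by (simp add: interval_integral_endpoints_reverse[of a b])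
  qed
qed

lemma interval_integral_has_real_derivative:
  fixes h :: "real \<Rightarrow> real"
  assumes "continuous_on UNIV h"
  shows "((\<lambda>t. LBINT s=0..t. h s) has_real_derivative h t) (at t)"
proof -
  \<comment> \<open>the margin of 1 makes \<open>t\<close> an interior point, so that the derivative is two-sided\<close>
  define a b where "a = min 0 t - 1" and "b = max 0 t + 1"
  have "((\<lambda>u. LBINT s=ereal 0..ereal u. h s) has_vector_derivative h t) (at t within {a..b})"
    using assms by (intro interval_integral_FTC2) (auto simp: a_def b_def intro: continuous_on_subset)
  moreover have "at t within {a..b} = at t"
    by (rule at_within_interior) (auto simp: a_def b_def)
  ultimately show ?thesis
    by (simp add: has_real_derivative_iff_has_vector_derivative zero_ereal_def)
qed

section \<open>Functions and flows in charts\<close>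

lemma chart_props:
  assumes "Ck_manifold m A" and "c \<in> A"
  shows "open (fst c)" and "open (snd c ` fst c)"
    and "continuous_on (fst c) (snd c)" and "continuous_on (snd c ` fst c) (chart_inv c)"
    and "\<And>x. x \<in> fst c \<Longrightarrow> chart_inv c (snd c x) = x"
    and "\<And>p. p \<in> snd c ` fst c \<Longrightarrow> chart_inv c p \<in> fst c"
proof -
  have *: "open (fst c)" "open (snd c ` fst c)"
    "homeomorphism (fst c) (snd c ` fst c) (snd c) (chart_inv c)"
    using assms unfolding Ck_manifold_def by blast+
  show "open (fst c)" "open (snd c ` fst c)"
    by (rule *)+
  show "continuous_on (fst c) (snd c)" "continuous_on (snd c ` fst c) (chart_inv c)"
    "\<And>x. x \<in> fst c \<Longrightarrow> chart_inv c (snd c x) = x"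
    using *(3) unfolding homeomorphism_def by blast+
  show "\<And>p. p \<in> snd c ` fst c \<Longrightarrow> chart_inv c p \<in> fst c"
    by (rule inv_into_into)
qed

lemma tangent_vector_off_chart:
  "v \<in> tangent_space A x \<Longrightarrow> c \<notin> charts_at A x \<Longrightarrow> v c = 0"
  unfolding tangent_space_def by blast

lemma chart_at_in_charts_at:
  assumes "Ck_manifold m A"
  shows "chart_at A x \<in> charts_at A x"
proof -
  have "\<exists>c. c \<in> charts_at A x"
    using assms unfolding Ck_manifold_def charts_at_def by blast
  then show ?thesis
    unfolding chart_at_def by (rule someI_ex)
qed

lemma Ck_fun_imp_continuous_on:
  assumes M: "Ck_manifold m A" and S: "open S" and h: "Ck_fun k A h S"
  shows "continuous_on S h"
proof -
  have "continuous_on (fst c \<inter> S) h" if "c \<in> A" for c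
  proof -
    note c = chart_props[OF M that]
    have "continuous_on (snd c ` (fst c \<inter> S)) (h \<circ> chart_inv c)"
      using h that unfolding Ck_fun_def Ck_on.simps(1)[symmetric] by (blast intro: Ck_on_mono)
    then have "continuous_on (fst c \<inter> S) (\<lambda>x. (h \<circ> chart_inv c) (snd c x))"
      by (rule continuous_on_compose2) (use c(3) in \<open>auto intro: continuous_on_subset\<close>)
    then show ?thesis
      by (rule continuous_on_eq) (simp add: c(5))
  qed
  then have "continuous_on (\<Union>c\<in>A. fst c \<inter> S) h"
    using chart_props(1)[OF M] S by (intro continuous_on_open_UN) auto
  moreover have "(\<Union>c\<in>A. fst c \<inter> S) = S"
    using M unfolding Ck_manifold_def by blast
  ultimately show ?thesis
    by simp
qed

lemma continuous_on_flow:
  assumes "Ck_flow k A \<phi>"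
  shows "continuous_on UNIV (\<lambda>t. \<phi> t x)" and "continuous_on UNIV (\<phi> t)"
proof -
  have *: "continuous_on UNIV (\<lambda>(t, x). \<phi> t x)"
    using assms unfolding Ck_flow_def by blast
  show "continuous_on UNIV (\<lambda>t. \<phi> t x)"
    using continuous_on_compose2[OF *, of UNIV "\<lambda>t. (t, x)"] by (simp add: continuous_intros)
  show "continuous_on UNIV (\<phi> t)"
    using continuous_on_compose2[OF *, of UNIV "\<lambda>x. (t, x)"] by (simp add: continuous_intros)
qed

lemma open_flow_preimage:
  assumes M: "Ck_manifold m A" and flow: "Ck_flow k A \<phi>" and c: "c \<in> A" and S: "open S"
  shows "open {(t, p). p \<in> snd c ` fst c \<and> \<phi> t (chart_inv c p) \<in> S}"
proof -
  let ?N = "snd c ` fst c"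
  have joint: "continuous_on UNIV (\<lambda>(t, x). \<phi> t x)"
    using flow unfolding Ck_flow_def by blast
  have pair: "continuous_on (UNIV \<times> ?N) (\<lambda>z. (fst z, chart_inv c (snd z)))"
    using chart_props(4)[OF M c]
    by (intro continuous_on_Pair continuous_on_fst continuous_on_id
        continuous_on_compose2[OF _ continuous_on_snd[OF continuous_on_id]]) auto
  have "continuous_on (UNIV \<times> ?N) (\<lambda>z. \<phi> (fst z) (chart_inv c (snd z)))"
    using continuous_on_compose2[OF joint pair] by simp
  then have "open ((\<lambda>z. \<phi> (fst z) (chart_inv c (snd z))) -` S \<inter> UNIV \<times> ?N)"
    using chart_props(2)[OF M c] S
    by (simp add: continuous_on_open_vimage open_Times)
  also have "(\<lambda>z. \<phi> (fst z) (chart_inv c (snd z))) -` S \<inter> UNIV \<times> ?N =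
      {(t, p). p \<in> ?N \<and> \<phi> t (chart_inv c p) \<in> S}"
    by auto
  finally show ?thesis .
qed

lemma Ck_flow_coordinates:
  assumes "Ck_flow l A \<phi>" and "1 \<le> l" and "c \<in> A" and "d \<in> A"
  shows "Ck_on 1 (\<lambda>(t, p). snd d (\<phi> t (chart_inv c p)))
    {(t, p). p \<in> snd c ` fst c \<and> \<phi> t (chart_inv c p) \<in> fst d}"
  using assms unfolding Ck_flow_def by (blast intro: Ck_on_mono)

text \<open>The derivative in the space variable is the restriction of the joint derivative. The two are
  needed together for the chain rule along \<open>q \<mapsto> (T(q), q)\<close>.\<close>

lemma flow_coordinates_has_derivative:
  assumes flow: "Ck_flow l A \<phi>" "1 \<le> l" and c: "c \<in> charts_at A x" and d: "d \<in> charts_at A (\<phi> t x)"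
    and M: "Ck_manifold m A"
  defines "D \<equiv> frechet_derivative (\<lambda>(t, p). snd d (\<phi> t (chart_inv c p))) (at (t, snd c x))"
  shows "((\<lambda>(t, p). snd d (\<phi> t (chart_inv c p))) has_derivative D) (at (t, snd c x))"
    and "(snd d \<circ> \<phi> t \<circ> chart_inv c has_derivative (\<lambda>w. D (0, w))) (at (snd c x))"
proof -
  let ?G = "\<lambda>(t, p). snd d (\<phi> t (chart_inv c p))"
  have "?G differentiable (at (t, snd c x))"
    using Ck_flow_coordinates[OF flow, of c d] c d chart_props(5)[OF M, of c x]
    unfolding Ck_on_1_iff charts_at_def by auto
  then show G: "(?G has_derivative D) (at (t, snd c x))"
    unfolding D_def by (simp add: frechet_derivative_works)
  have "((\<lambda>p. (t, p)) has_derivative (\<lambda>w. (0, w))) (at (snd c x))"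
    by (auto intro!: derivative_eq_intros)
  from has_derivative_compose[OF this G]
  show "(snd d \<circ> \<phi> t \<circ> chart_inv c has_derivative (\<lambda>w. D (0, w))) (at (snd c x))"
    by (simp add: o_def)
qed

lemma Ck_fun_along_flow:
  assumes M: "Ck_manifold m A" and flow: "Ck_flow l A \<phi>" "1 \<le> l" and c: "c \<in> A"
    and S: "open S" and r: "Ck_fun 1 A r S"
  shows "Ck_on 1 (\<lambda>(t, p). r (\<phi> t (chart_inv c p)))
    {(t, p). p \<in> snd c ` fst c \<and> \<phi> t (chart_inv c p) \<in> S}"
proof (rule Ck_on_1_locally)
  fix z
  assume "z \<in> {(t, p). p \<in> snd c ` fst c \<and> \<phi> t (chart_inv c p) \<in> S}"
  then obtain t x where z: "z = (t, snd c x)" and x: "x \<in> fst c"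
    and "\<phi> t (chart_inv c (snd c x)) \<in> S"
    by auto
  then have xS: "\<phi> t x \<in> S"
    by (simp add: chart_props(5)[OF M c])
  obtain e where e: "e \<in> A" "\<phi> t x \<in> fst e"
    using M unfolding Ck_manifold_def by blast
  let ?U = "{(t, p). p \<in> snd c ` fst c \<and> \<phi> t (chart_inv c p) \<in> fst e \<inter> S}"
  let ?k = "\<lambda>z. (r \<circ> chart_inv e) ((\<lambda>(t, p). snd e (\<phi> t (chart_inv c p))) z)"
  have "open ?U"
    using chart_props(1)[OF M e(1)] S by (intro open_flow_preimage[OF M flow(1) c]) auto
  moreover have "(t, snd c x) \<in> ?U"
    using x xS e by (simp add: chart_props(5)[OF M c])
  moreover have "Ck_on 1 ?k ?U"
  proof (rule Ck_on_1_compose[where h = "r \<circ> chart_inv e"])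
    show "Ck_on 1 (r \<circ> chart_inv e) (snd e ` (fst e \<inter> S))"
      using r e(1) unfolding Ck_fun_def by blast
    show "Ck_on 1 (\<lambda>(t, p). snd e (\<phi> t (chart_inv c p))) ?U"
      by (rule Ck_on_subset[OF Ck_flow_coordinates[OF flow c e(1)]]) auto
  qed auto
  moreover have "\<forall>z\<in>?U. (case z of (t, p) \<Rightarrow> r (\<phi> t (chart_inv c p))) = ?k z"
    by (auto simp: chart_props(5)[OF M e(1)])
  ultimately show "\<exists>U k. open U \<and> z \<in> U \<and> Ck_on 1 k U \<and>
      (\<forall>z\<in>U. (case z of (t, p) \<Rightarrow> r (\<phi> t (chart_inv c p))) = k z)"
    unfolding z by (intro exI[of _ ?U] exI[of _ ?k] conjI)
qed

text \<open>This identifies the integrand of \<open>\<kappa>\<close> with the partial derivative of \<open>r(\<phi>\<^sup>t(q))\<close> that the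
  Leibniz rule produces. It is the chain rule through a chart at \<open>\<phi>\<^sup>t(x)\<close>, the one in which the
  differential of \<open>r\<close> is computed.\<close>

lemma fun_differential_along_flow:
  assumes M: "Ck_manifold m A" and flow: "Ck_flow l A \<phi>" "1 \<le> l"
    and S: "open S" "\<phi> t x \<in> S" and r: "Ck_fun 1 A r S"
  shows "fun_differential A r (\<phi> t x) (map_differential A (\<phi> t) x v) =
    frechet_derivative (\<lambda>p. r (\<phi> t (chart_inv (chart_at A x) p)))
      (at (snd (chart_at A x) x)) (v (chart_at A x))"
proof -
  define c e where "c = chart_at A x" and "e = chart_at A (\<phi> t x)"
  define p where "p = snd c x"
  have c: "c \<in> charts_at A x" and e: "e \<in> charts_at A (\<phi> t x)"
    unfolding c_def e_def by (rule chart_at_in_charts_at[OF M])+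
  then have cA: "c \<in> A" "x \<in> fst c" and eA: "e \<in> A" "\<phi> t x \<in> fst e"
    by (auto simp: charts_at_def)
  have inv: "chart_inv c p = x"
    unfolding p_def by (rule chart_props(5)[OF M cA])
  let ?F = "snd e \<circ> \<phi> t \<circ> chart_inv c"
  let ?R = "r \<circ> chart_inv e"
  have F: "(?F has_derivative frechet_derivative ?F (at p)) (at p)"
    using flow_coordinates_has_derivative(2)[OF flow c e M]
    unfolding p_def by (metis frechet_derivative_at)
  have "?R differentiable (at (?F p))"
    using r eA S(2) inv unfolding Ck_fun_def Ck_on_1_iff by auto
  then have R: "(?R has_derivative frechet_derivative ?R (at (?F p))) (at (?F p))"
    by (simp add: frechet_derivative_works)
  let ?U = "{q. (t, q) \<in> {(t, p). p \<in> snd c ` fst c \<and> \<phi> t (chart_inv c p) \<in> fst e}}"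
  have "open ((\<lambda>q. (t, q)) -` {(t, p). p \<in> snd c ` fst c \<and> \<phi> t (chart_inv c p) \<in> fst e})"
    using open_flow_preimage[OF M flow(1) cA(1) chart_props(1)[OF M eA(1)]]
    by (rule open_vimage) (auto intro!: continuous_intros)
  then have U: "open ?U"
    by (simp add: vimage_def)
  have pU: "p \<in> ?U"
    using cA(2) eA(2) inv by (auto simp: p_def)
  have "((\<lambda>q. r (\<phi> t (chart_inv c q))) has_derivative
      (\<lambda>w. frechet_derivative ?R (at (?F p)) (frechet_derivative ?F (at p) w))) (at p)"
    by (rule has_derivative_transform_within_open[OF has_derivative_compose[OF F R] U pU])
      (simp add: chart_props(5)[OF M eA(1)])
  then have "frechet_derivative (\<lambda>q. r (\<phi> t (chart_inv c q))) (at p) =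
      (\<lambda>w. frechet_derivative ?R (at (?F p)) (frechet_derivative ?F (at p) w))"
    by (metis frechet_derivative_at)
  then show ?thesis
    using e inv unfolding fun_differential_def map_differential_def c_def[symmetric]
      e_def[symmetric] p_def[symmetric] by (simp add: o_def)
qed

section \<open>The time change along an orbit\<close>

lemma flow_at_nonfixed:
  assumes flow: "Ck_flow k A \<phi>" and x: "x \<in> nonfixed \<phi>"
  shows "\<phi> s x \<in> nonfixed \<phi>"
proof (rule ccontr)
  assume "\<phi> s x \<notin> nonfixed \<phi>"
  then have "\<phi> t (\<phi> s x) = \<phi> s x" for t
    by (simp add: nonfixed_def)
  moreover have "\<phi> t (\<phi> s x) = \<phi> (t + s) x" "\<phi> 0 x = x" for t
    using flow unfolding Ck_flow_def by metis+
  ultimately have "\<phi> (t + s) x = \<phi> s x" for t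
    by simp
  from this[of "- s"] this[of "_ - s"] have "\<phi> t x = x" for t
    using \<open>\<phi> 0 x = x\<close> by simp
  then show False
    using x by (simp add: nonfixed_def)
qed

lemma open_nonfixed:
  fixes \<phi> :: "real \<Rightarrow> 'a::t2_space \<Rightarrow> 'a"
  assumes "Ck_flow k A \<phi>"
  shows "open (nonfixed \<phi>)"
proof -
  have "open {x. \<phi> t x \<noteq> x}" for t
    by (intro open_Collect_neq continuous_on_flow(2)[OF assms] continuous_on_id)
  then show ?thesis
    unfolding nonfixed_def Collect_ex_eq by blast
qed

text \<open>The associated function prescribes the derivative of a time change only at time \<open>0\<close>. Restarting
  the time change at \<open>\<phi>r\<^sup>\<tau>(x)\<close> carries this to every time \<open>\<tau>\<close>.\<close>

lemma time_change_shift: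
  assumes \<phi>: "Ck_flow k A \<phi>" and \<phi>r: "Ck_flow k' A' \<phi>r" and \<theta>: "time_change \<phi> \<phi>r x \<theta>"
  shows "time_change \<phi> \<phi>r (\<phi>r \<tau> x) (\<lambda>\<sigma>. \<theta> (\<sigma> + \<tau>) - \<theta> \<tau>)"
  unfolding time_change_def
proof (intro conjI allI)
  have cont: "continuous_on UNIV \<theta>" and mono: "strict_mono \<theta>"
    and eq: "\<And>\<tau>. \<phi>r \<tau> x = \<phi> (\<theta> \<tau>) x"
    using \<theta> unfolding time_change_def by blast+
  show "continuous_on UNIV (\<lambda>\<sigma>. \<theta> (\<sigma> + \<tau>) - \<theta> \<tau>)"
    by (intro continuous_intros continuous_on_compose2[OF cont]) auto
  show "strict_mono (\<lambda>\<sigma>. \<theta> (\<sigma> + \<tau>) - \<theta> \<tau>)"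
    using mono by (simp add: strict_mono_def)
  show "\<phi>r \<sigma> (\<phi>r \<tau> x) = \<phi> (\<theta> (\<sigma> + \<tau>) - \<theta> \<tau>) (\<phi>r \<tau> x)" for \<sigma>
  proof -
    have "\<phi>r \<sigma> (\<phi>r \<tau> x) = \<phi> ((\<theta> (\<sigma> + \<tau>) - \<theta> \<tau>) + \<theta> \<tau>) x"
      using \<phi>r eq[of "\<sigma> + \<tau>"] unfolding Ck_flow_def by simp
    also have "\<dots> = \<phi> (\<theta> (\<sigma> + \<tau>) - \<theta> \<tau>) (\<phi> (\<theta> \<tau>) x)"
      using \<phi> unfolding Ck_flow_def by blast
    finally show ?thesis
      by (simp add: eq)
  qed
qed simp

lemma time_change_has_real_derivative:
  assumes \<phi>: "Ck_flow k A \<phi>" and \<phi>r: "Ck_flow k' A' \<phi>r"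
    and r: "associated_function l A \<phi> \<phi>r r"
    and x: "x \<in> nonfixed \<phi>" and \<theta>: "time_change \<phi> \<phi>r x \<theta>"
  shows "(\<theta> has_real_derivative 1 / r (\<phi> (\<theta> \<tau>) x)) (at \<tau>)"
proof -
  have eq: "\<phi>r \<tau> x = \<phi> (\<theta> \<tau>) x"
    using \<theta> unfolding time_change_def by blast
  have "\<phi>r \<tau> x \<in> nonfixed \<phi>"
    unfolding eq by (rule flow_at_nonfixed[OF \<phi> x])
  then obtain d where d: "((\<lambda>\<sigma>. \<theta> (\<sigma> + \<tau>) - \<theta> \<tau>) has_real_derivative d) (at 0)"
    and "r (\<phi>r \<tau> x) = inverse d"
    using r time_change_shift[OF \<phi> \<phi>r \<theta>, of \<tau>] unfolding associated_function_def by blast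
  then have d_eq: "d = 1 / r (\<phi> (\<theta> \<tau>) x)"
    by (simp add: eq divide_inverse)
  have "((\<lambda>\<sigma>. \<theta> (\<sigma> + \<tau>)) has_real_derivative d) (at 0)"
    using DERIV_add[OF d DERIV_const[of "\<theta> \<tau>"]] by simp
  then have "(\<theta> has_real_derivative d) (at \<tau>)"
    using DERIV_at_within_shift[of \<theta> d \<tau> 0 UNIV] by (simp add: add.commute)
  then show ?thesis
    by (simp add: d_eq)
qed

text \<open>On a non-fixed orbit the defining relation \<open>d\<tau> = r dt\<close> makes \<open>new_time\<close> a left inverse of
  \<open>\<theta>\<close>. As \<open>r > 0\<close> it is injective, so it is a two-sided inverse; in particular \<open>\<theta>\<close> is onto.\<close>

lemma flow_new_time:
  fixes A :: "('a::{t2_space, second_countable_topology}, 'e::euclidean_space) chart set"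
  assumes M: "Ck_manifold m A" and \<phi>: "Ck_flow k A \<phi>"
    and \<phi>r: "time_reparameterization l A \<phi> \<phi>r"
    and r: "associated_function l A \<phi> \<phi>r r"
  shows "\<phi>r (new_time \<phi> r x t) x = \<phi> t x"
proof -
  have \<phi>r': "Ck_flow l A \<phi>r"
    using \<phi>r unfolding time_reparameterization_def by blast
  obtain \<theta> where \<theta>: "time_change \<phi> \<phi>r x \<theta>"
    using \<phi>r unfolding time_reparameterization_def by blast
  then have \<theta>0: "\<theta> 0 = 0" and eq: "\<And>\<tau>. \<phi>r \<tau> x = \<phi> (\<theta> \<tau>) x"
    unfolding time_change_def by blast+
  show ?thesis
  proof (cases "x \<in> nonfixed \<phi>")
    case False
    then show ?thesis
      by (simp add: eq nonfixed_def)
  next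
    case True
    have pos: "r (\<phi> s x) > 0" for s
      using r flow_at_nonfixed[OF \<phi> True, of s] unfolding associated_function_def by blast
    have "continuous_on (nonfixed \<phi>) r"
      using r unfolding associated_function_def
      by (intro Ck_fun_imp_continuous_on[OF M open_nonfixed[OF \<phi>]]) blast
    then have "continuous_on UNIV (\<lambda>s. r (\<phi> s x))"
      using flow_at_nonfixed[OF \<phi> True]
      by (intro continuous_on_compose2[OF _ continuous_on_flow(1)[OF \<phi>]]) auto
    then have T: "((\<lambda>t. new_time \<phi> r x t) has_real_derivative r (\<phi> t x)) (at t)" for t
      unfolding new_time_def by (rule interval_integral_has_real_derivative)
    have "((\<lambda>\<tau>. new_time \<phi> r x (\<theta> \<tau>) - \<tau>) has_real_derivative 0) (at \<tau>)" for \<tau>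
    proof -
      have "((\<lambda>\<tau>. new_time \<phi> r x (\<theta> \<tau>) - \<tau>) has_real_derivative
          r (\<phi> (\<theta> \<tau>) x) * (1 / r (\<phi> (\<theta> \<tau>) x)) - 1) (at \<tau>)"
        by (intro DERIV_diff DERIV_chain2[OF T] DERIV_ident
            time_change_has_real_derivative[OF \<phi> \<phi>r' r True \<theta>])
      then show ?thesis
        using pos[of "\<theta> \<tau>"] by simp
    qed
    then have "new_time \<phi> r x (\<theta> \<tau>) - \<tau> = new_time \<phi> r x (\<theta> 0) - 0" for \<tau>
      by (intro DERIV_isconst_all) blast
    then have left_inv: "new_time \<phi> r x (\<theta> \<tau>) = \<tau>" for \<tau>
      by (simp add: \<theta>0 new_time_def zero_ereal_def)
    have "new_time \<phi> r x s < new_time \<phi> r x t" if "s < t" for s t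
      using DERIV_pos_imp_increasing[OF that, of "new_time \<phi> r x"] T pos by blast
    then have "inj (new_time \<phi> r x)"
      by (intro linorder_injI) (metis less_irrefl)
    then have "\<theta> (new_time \<phi> r x t) = t"
      using left_inv by (metis injD)
    then show ?thesis
      by (simp add: eq)
  qed
qed

text \<open>At a fixed point the time change need not be differentiable, but then the orbit of \<open>\<phi>r\<close> is
  constant and \<open>f\<close> vanishes.\<close>

lemma reparameterized_velocity:
  assumes \<phi>: "Ck_flow k A \<phi>" and gen: "generates A f \<phi>"
    and \<phi>r: "time_reparameterization l A \<phi> \<phi>r"
    and r: "associated_function l A \<phi> \<phi>r r"
    and d: "d \<in> charts_at A (\<phi>r \<tau> x)"
  shows "((\<lambda>\<sigma>. snd d (\<phi>r \<sigma> x)) has_vector_derivative (1 / r (\<phi>r \<tau> x)) *\<^sub>R f (\<phi>r \<tau> x) d) (at \<tau>)"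
proof -
  have \<phi>r': "Ck_flow l A \<phi>r"
    using \<phi>r unfolding time_reparameterization_def by blast
  obtain \<theta> where \<theta>: "time_change \<phi> \<phi>r x \<theta>"
    using \<phi>r unfolding time_reparameterization_def by blast
  then have eq: "\<And>\<tau>. \<phi>r \<tau> x = \<phi> (\<theta> \<tau>) x"
    unfolding time_change_def by blast
  have vel: "((\<lambda>s. snd d (\<phi> s x)) has_vector_derivative f (\<phi>r \<tau> x) d) (at (\<theta> \<tau>))"
    using gen d unfolding generates_def eq by blast
  show ?thesis
  proof (cases "x \<in> nonfixed \<phi>")
    case True
    have "(\<theta> has_vector_derivative 1 / r (\<phi>r \<tau> x)) (at \<tau>)"
      using time_change_has_real_derivative[OF \<phi> \<phi>r' r True \<theta>]
      by (simp add: eq has_real_derivative_iff_has_vector_derivative)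
    from vector_diff_chain_at[OF this vel] show ?thesis
      by (simp add: eq o_def)
  next
    case False
    then have fixed: "\<phi> s x = x" for s
      by (simp add: nonfixed_def)
    then have "((\<lambda>s. snd d x) has_vector_derivative f (\<phi>r \<tau> x) d) (at (\<theta> \<tau>))"
      using vel by simp
    then have "f (\<phi>r \<tau> x) d = 0"
      using vector_derivative_unique_at has_vector_derivative_const by blast
    then show ?thesis
      by (simp add: eq fixed)
  qed
qed

text \<open>For \<open>l \<ge> 2\<close> the open set is the whole manifold if \<open>r\<close> is regular there. Otherwise \<open>f\<close> does not
  vanish at \<open>x\<close>, so \<open>x\<close> is not fixed, and the set of non-fixed points serves.\<close>

lemma M_hat_orbit_neighbourhood:
  fixes A :: "('a::{t2_space, second_countable_topology}, 'e::euclidean_space) chart set"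
  assumes M: "Ck_manifold m A" and l: "1 \<le> l" and \<phi>: "Ck_flow l A \<phi>" and gen: "generates A f \<phi>"
    and f: "f x \<in> tangent_space A x"
    and r: "associated_function l A \<phi> \<phi>r r" and x: "x \<in> M_hat l A f r"
    and C1: "l = 1 \<Longrightarrow> \<exists>S. open S \<and> range (\<lambda>t. \<phi> t x) \<subseteq> S \<and> Ck_fun 1 A r S"
  obtains S where "open S" and "\<And>t. \<phi> t x \<in> S" and "Ck_fun 1 A r S"
proof (cases "l = 1")
  case True
  then show ?thesis
    using C1 that by blast
next
  case False
  then have l2: "1 \<le> l - 1"
    using l by simp
  show ?thesis
  proof (cases "Ck_fun (l - 1) A r UNIV")
    case True
    then have "Ck_fun 1 A r UNIV"
      using l2 unfolding Ck_fun_def by (blast intro: Ck_on_mono)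
    then show ?thesis
      by (intro that[of UNIV]) auto
  next
    case False
    then have "f x \<noteq> tzero"
      using x unfolding M_hat_def by simp
    then obtain d where d: "f x d \<noteq> 0"
      unfolding tzero_def by (meson ext)
    have dx: "d \<in> charts_at A x"
      using tangent_vector_off_chart[OF f] d by blast
    have \<phi>0: "\<phi> 0 x = x"
      using \<phi> unfolding Ck_flow_def by blast
    have nf: "x \<in> nonfixed \<phi>"
    proof (rule ccontr)
      assume "x \<notin> nonfixed \<phi>"
      then have "\<phi> s x = x" for s
        by (simp add: nonfixed_def)
      moreover have "((\<lambda>s. snd d (\<phi> s x)) has_vector_derivative f x d) (at 0)"
        using gen dx \<phi>0 unfolding generates_def by metis
      ultimately have "((\<lambda>s. snd d x) has_vector_derivative f x d) (at 0)"
        by simp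
      then show False
        using d vector_derivative_unique_at has_vector_derivative_const by blast
    qed
    have "Ck_fun 1 A r (nonfixed \<phi>)"
      using r l2 unfolding associated_function_def Ck_fun_def by (blast intro: Ck_on_mono)
    then show ?thesis
      using flow_at_nonfixed[OF \<phi> nf] open_nonfixed[OF \<phi>] that by blast
  qed
qed

section \<open>The derivative of the reparameterized flow\<close>

theorem proposition1:
  fixes A :: "('a::{t2_space, second_countable_topology}, 'e::euclidean_space) chart set"
    and g :: "'a \<Rightarrow> ('a, 'e) tvec \<Rightarrow> ('a, 'e) tvec \<Rightarrow> real"
    and f :: "'a \<Rightarrow> ('a, 'e) tvec"
    and \<phi> \<phi>r :: "real \<Rightarrow> 'a \<Rightarrow> 'a"
    and x :: "'a" and v :: "('a, 'e) tvec"
    and r :: "'a \<Rightarrow> real"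
    and y z :: "real \<Rightarrow> ('a, 'e) tvec"
    and \<kappa> :: "real \<Rightarrow> real"
    and m l :: nat
  assumes "2 \<le> m" and "1 \<le> l" and "l < m"
    and "Ck_manifold m A"
    and "riemannian_metric (m - 1) A g"
    and "Ck_vector_field l A f"
    and "Ck_flow l A \<phi>" and "generates A f \<phi>"
    and "time_reparameterization l A \<phi> \<phi>r"
    and "associated_function l A \<phi> \<phi>r r"
    and "x \<in> M_hat l A f r"
    and "v \<in> tangent_space A x"
    \<comment> \<open>for \<open>l \<ge> 2\<close> the function \<open>r\<close> is \<open>C\<^sup>1\<close> anyway; for \<open>l = 1\<close> its derivative has to make sense
        along the orbit of \<open>x\<close>\<close>
    and "l = 1 \<Longrightarrow> \<exists>S. open S \<and> range (\<lambda>t. \<phi> t x) \<subseteq> S \<and> Ck_fun 1 A r S"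
    and "\<And>t. y t = map_differential A (\<phi> t) x v"
    and "\<And>\<tau>. z \<tau> = map_differential A (\<phi>r \<tau>) x v"
    and "\<And>t. \<kappa> t = - (LBINT s=0..t. fun_differential A r (\<phi> s x) (y s))"
  shows "\<forall>t. z (new_time \<phi> r x t) =
    tadd (y t) (tscale (\<kappa> t) (tscale (1 / r (\<phi> t x)) (f (\<phi> t x))))"
proof
  fix t
  note M = assms(4) and \<phi> = assms(7) and gen = assms(8) and \<phi>r = assms(9) and r = assms(10)
    and y = assms(14) and z = assms(15) and \<kappa> = assms(16) and l = assms(2)
  have \<phi>r': "Ck_flow l A \<phi>r"
    using \<phi>r unfolding time_reparameterization_def by blast
  have f: "f q \<in> tangent_space A q" for q
    using assms(6) unfolding Ck_vector_field_def by blast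
  obtain S where S: "open S" "\<And>t. \<phi> t x \<in> S" and rS: "Ck_fun 1 A r S"
    using M_hat_orbit_neighbourhood[OF M l \<phi> gen f r assms(11) assms(13)] by blast
  define c where "c = chart_at A x"
  define p where "p = snd c x"
  have c: "c \<in> charts_at A x"
    unfolding c_def by (rule chart_at_in_charts_at[OF M])
  then have cA: "c \<in> A" "x \<in> fst c"
    by (auto simp: charts_at_def)
  have inv: "chart_inv c p = x"
    unfolding p_def by (rule chart_props(5)[OF M cA])
  have pN: "p \<in> snd c ` fst c"
    using cA by (simp add: p_def)

  define \<tau> where "\<tau> = new_time \<phi> r x t"
  have \<tau>: "\<phi>r \<tau> x = \<phi> t x"
    unfolding \<tau>_def by (rule flow_new_time[OF M \<phi> \<phi>r r])
  define T where "T = (\<lambda>q. new_time \<phi> r (chart_inv c q) t)"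
  define T' where
    "T' = (\<lambda>w. LBINT s=0..t. frechet_derivative (\<lambda>q. r (\<phi> s (chart_inv c q))) (at p) w)"
  have Tp: "T p = \<tau>"
    by (simp add: T_def \<tau>_def inv)
  have T: "(T has_derivative T') (at p)"
    using has_derivative_interval_integral[OF Ck_fun_along_flow[OF M \<phi> l cA(1) S(1) rS]
        open_flow_preimage[OF M \<phi> cA(1) S(1)], of 0 t p] pN S(2)
    by (simp add: T_def T'_def new_time_def inv zero_ereal_def)
  have T'v: "T' (v c) = - \<kappa> t"
    unfolding T'_def \<kappa> y fun_differential_along_flow[OF M \<phi> l S(1) S(2) rS] c_def p_def by simp

  show "z (new_time \<phi> r x t) =
    tadd (y t) (tscale (\<kappa> t) (tscale (1 / r (\<phi> t x)) (f (\<phi> t x))))"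
  proof
    fix d
    show "z (new_time \<phi> r x t) d =
      tadd (y t) (tscale (\<kappa> t) (tscale (1 / r (\<phi> t x)) (f (\<phi> t x)))) d"
    proof (cases "d \<in> charts_at A (\<phi> t x)")
      case False
      then have "f (\<phi> t x) d = 0"
        using f by (rule tangent_vector_off_chart[rotated])
      then show ?thesis
        using False \<tau> unfolding y z \<tau>_def[symmetric]
        by (simp add: map_differential_def tadd_def tscale_def)
    next
      case True
      then have d: "d \<in> charts_at A (\<phi>r \<tau> x)"
        by (simp add: \<tau>)
      define D where
        "D = frechet_derivative (\<lambda>(t, p). snd d (\<phi>r t (chart_inv c p))) (at (\<tau>, p))"
      note G = flow_coordinates_has_derivative[OF \<phi>r' l c d M, folded p_def, folded D_def]
      have z_d: "z \<tau> d = D (0, v c)"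
        using d unfolding z map_differential_def
        by (simp add: c_def[symmetric] p_def[symmetric] frechet_derivative_at[OF G(2), symmetric])
      have y_d: "y t d = frechet_derivative (snd d \<circ> \<phi> t \<circ> chart_inv c) (at p) (v c)"
        using True unfolding y map_differential_def
        by (simp add: c_def[symmetric] p_def[symmetric])

      \<comment> \<open>differentiate the identity \<open>\<phi>r\<^bsup>T(q)\<^esup>(q) = \<phi>\<^sup>t(q)\<close> in \<open>q\<close>\<close>
      have "((\<lambda>q. (T q, q)) has_derivative (\<lambda>w. (T' w, w))) (at p)"
        by (intro has_derivative_Pair T has_derivative_ident)
      from has_derivative_compose[OF this, unfolded Tp, OF G(1)]
      have "((\<lambda>q. snd d (\<phi>r (T q) (chart_inv c q))) has_derivative (\<lambda>w. D (T' w, w))) (at p)"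
        by simp
      moreover have "(\<lambda>q. snd d (\<phi>r (T q) (chart_inv c q))) = snd d \<circ> \<phi> t \<circ> chart_inv c"
        by (simp add: T_def flow_new_time[OF M \<phi> \<phi>r r] o_def)
      ultimately have y_D: "y t d = D (T' (v c), v c)"
        unfolding y_d using frechet_derivative_at by metis

      \<comment> \<open>the time component of the joint derivative is the velocity of \<open>\<phi>r\<close>\<close>
      have "((\<lambda>\<sigma>. (\<sigma>, p)) has_derivative (\<lambda>h. (h, 0))) (at \<tau>)"
        by (auto intro!: derivative_eq_intros)
      from has_derivative_compose[OF this G(1)]
      have "((\<lambda>\<sigma>. snd d (\<phi>r \<sigma> x)) has_derivative (\<lambda>h. D (h, 0))) (at \<tau>)"
        by (simp add: inv)
      moreover have "((\<lambda>\<sigma>. snd d (\<phi>r \<sigma> x)) has_derivative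
          (\<lambda>h. h *\<^sub>R ((1 / r (\<phi> t x)) *\<^sub>R f (\<phi> t x) d))) (at \<tau>)"
        using reparameterized_velocity[OF \<phi> gen \<phi>r r d] unfolding \<tau> has_vector_derivative_def .
      ultimately have D_time: "D (h, 0) = h *\<^sub>R ((1 / r (\<phi> t x)) *\<^sub>R f (\<phi> t x) d)" for h
        by (metis has_derivative_unique)

      have "linear D"
        using G(1) by (rule has_derivative_linear)
      then have "D (T' (v c), v c) = D (T' (v c), 0) + D (0, v c)"
        using linear_add[of D "(T' (v c), 0)" "(0, v c)"] by simp
      then have "y t d = z \<tau> d + (- \<kappa> t) *\<^sub>R ((1 / r (\<phi> t x)) *\<^sub>R f (\<phi> t x) d)"
        by (simp only: y_D z_d D_time T'v add.commute)
      then show ?thesis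
        unfolding \<tau>_def[symmetric] by (simp add: tadd_def tscale_def)
    qed
  qed
qed

end
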